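(* Let $\Theta$ be a convex closed set in $\mathbb{R}^M$, let $Z$ be a random variable with values in a set $\mathcal{Z}$, and let $Q:\Theta\times\mathcal{Z}\to\mathbb{R}_+$ be a loss function such that the random function $Q(\cdot,Z):\Theta\to\mathbb{R}_+$ is convex almost surely, with convex risk function $A:\Theta\to\mathbb{R}_+$, $A(\theta)=\mathbb{E}\,Q(\theta,Z)$. Let $Z_1,Z_2,\dots$ be i.i.d. with the same distribution as $Z$, and let $u_i(\theta)=\nabla_\theta Q(\theta,Z_i)$ be stochastic sub-gradients as in the context. Assume that $$\sup_{\theta\in\Theta}\mathbb{E}\,\|\nabla_\theta Q(\theta,Z)\|_\infty^2\le L_{\Theta,Q}^2,$$ where $L_{\Theta,Q}$ is a finite constant. Let $V$ be a proxy function on $\Theta$ satisfying Assumption (L) with a parameter $\alpha>0$, and assume that there exists $\theta_A^*\in\operatorname{Arg\,min}_{\theta\in\Theta}A(\theta)$. Then, for any integer $t\ge 1$, the estimate $\widehat\theta_t$ defined by the algorithm in the context with these stochastic sub-gradients and with $\gamma_i\equiv 1$, $\beta_i=\beta_0\sqrt{i+1}$, $i\ge1$, with arbitrary $\beta_0>0$, satisfies $$\mathbb{E}\,A(\widehat\theta_t)-\min_{\theta\in\Theta}A(\theta)\le\Big(\beta_0V(\theta_A^* )+\frac{L_{\Theta,Q}^2}{\alpha\beta_0}\Big)\frac{\sqrt{t+1}}{t}.$$ Furthermore, if $\overline V$ is a constant such that $V(\theta_A^* )\le\overline V$ and we set $\beta_0=L_{\Theta,Q}(\alpha\overline V)^{-1/2}$,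 then $$\mathbb{E}\,A(\widehat\theta_t)-\min_{\theta\in\Theta}A(\theta)\le 2L_{\Theta,Q}\big(\alpha^{-1}\overline V\big)^{1/2}\frac{\sqrt{t+1}}{t}.$$ In particular, if $\Theta$ is a convex compact set, we can take $\overline V=\max_{\theta\in\Theta}V(\theta)$.
   Context: Norms on $\mathbb{R}^M$: $\|z\|_1=\sum_{j}|z^{(j)}|$, $\|z\|_\infty=\max_j|z^{(j)}|$. Stochastic sub-gradients: $\nabla_\theta Q(\theta,z)$ is a measurable function on $\Theta\times\mathcal{Z}$ with values in $\mathbb{R}^M$ such that, for any $\theta\in\Theta$, $\mathbb{E}\,u_i(\theta)=\mathbb{E}\,\nabla_\theta Q(\theta,Z_i)$ belongs to the sub-differential of $A$ at $\theta$. $\beta$-conjugate: for a convex $V:\Theta\to\mathbb{R}$ and $\beta>0$, $W_\beta(z)=\sup_{\theta\in\Theta}\{-z^T\theta-\beta V(\theta)\}$, $z\in\mathbb{R}^M$. Assumption (L) with parameter $\alpha>0$: the convex function $V$ is such that, for every $\beta>0$, $W_\beta$ is continuously differentiable on $\mathbb{R}^M$ and $$\|\nabla W_\beta(z)-\nabla W_\beta(\tilde z)\|_1\le\frac{1}{\alpha\beta}\|z-\tilde z\|_\infty\quad\text{for all } z,\tilde z\in\mathbb{R}^M,$$ where $\alpha$ does not depend on $\beta$. Proxy function: a convex function $V:\Theta\to\mathbb{R}_+$ such that (i) there is $\theta_*\in\Theta$ with $V(\theta_* )=\min_{\theta\in\Theta}V(\theta)$, and (ii) Assumption (L) holds. Algorithm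 (mirror descent with averaging), for positive sequences $(\gamma_i)$ and $(\beta_i)$ with $\beta_i\ge\beta_{i-1}$. Fix the initial values $\theta_0\in\Theta$ and $\zeta_0=0\in\mathbb{R}^M$. For $i=1,\dots,t-1$ set $$\zeta_i=\zeta_{i-1}+\gamma_iu_i(\theta_{i-1}),\qquad\theta_i=-\nabla W_{\beta_i}(\zeta_i).$$ The output at iteration $t\ge1$ is $\widehat\theta_t=\big(\sum_{i=1}^t\gamma_i\theta_{i-1}\big)/\sum_{i=1}^t\gamma_i$, which depends only on $Z_1,\dots,Z_{t-1}$; for $\gamma_i\equiv1$ it equals $\frac1t\sum_{i=1}^t\theta_{i-1}$.
   Formalization: The initial value θ_0 is taken to be a minimiser of V on Θ instead of an arbitrary point of Θ; for arbitrary θ_0 the bound fails (Θ=R, V=x²/2, Q=|x|, t=1, θ_0 large). *)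

theory Defs
  imports "HOL-Probability.Probability"
begin

text \<open>The maximum norm on \<open>real ^ 'm\<close> is the library constant \<^const>\<open>infnorm\<close>.\<close>

definition l1_norm :: "real ^ 'm \<Rightarrow> real" where
  "l1_norm z = (\<Sum>j\<in>UNIV. \<bar>z $ j\<bar>)"

text \<open>Meaningful only at points of differentiability.\<close>

definition grad :: "('a::real_inner \<Rightarrow> real) \<Rightarrow> 'a \<Rightarrow> 'a" where
  "grad f x = (THE g. GDERIV f x :> g)"

definition continuously_differentiable :: "('a::real_inner \<Rightarrow> real) \<Rightarrow> bool" where
  "continuously_differentiable f \<longleftrightarrow>
     (\<forall>x. \<exists>g. GDERIV f x :> g) \<and> continuous_on UNIV (grad f)"

text \<open>The subdifferential of a function whose domain is \<open>\<Theta>\<close>: only points of \<open>\<Theta>\<close> are compared.\<close>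

definition subdifferential :: "'a::real_inner set \<Rightarrow> ('a \<Rightarrow> real) \<Rightarrow> 'a \<Rightarrow> 'a set" where
  "subdifferential \<Theta> f \<theta> = {g. \<forall>\<theta>'\<in>\<Theta>. f \<theta>' \<ge> f \<theta> + g \<bullet> (\<theta>' - \<theta>)}"

definition beta_conjugate ::
    "(real ^ 'm) set \<Rightarrow> (real ^ 'm \<Rightarrow> real) \<Rightarrow> real \<Rightarrow> real ^ 'm \<Rightarrow> real" where
  "beta_conjugate \<Theta> V \<beta> z = (SUP \<theta>\<in>\<Theta>. - (z \<bullet> \<theta>) - \<beta> * V \<theta>)"

text \<open>
  The real supremum in \<^const>\<open>beta_conjugate\<close> is only meaningful for sets that are bounded above.
  That the conjugate is a (finite) differentiable function on the whole space therefore
  includes the boundedness condition.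
\<close>

definition assumption_L :: "(real ^ 'm) set \<Rightarrow> (real ^ 'm \<Rightarrow> real) \<Rightarrow> real \<Rightarrow> bool" where
  "assumption_L \<Theta> V \<alpha> \<longleftrightarrow>
     (\<forall>\<beta>>0.
        (\<forall>z. bdd_above ((\<lambda>\<theta>. - (z \<bullet> \<theta>) - \<beta> * V \<theta>) ` \<Theta>)) \<and>
        continuously_differentiable (beta_conjugate \<Theta> V \<beta>) \<and>
        (\<forall>z z'. l1_norm (grad (beta_conjugate \<Theta> V \<beta>) z - grad (beta_conjugate \<Theta> V \<beta>) z')
                  \<le> 1 / (\<alpha> * \<beta>) * infnorm (z - z')))"

definition proxy_function :: "(real ^ 'm) set \<Rightarrow> (real ^ 'm \<Rightarrow> real) \<Rightarrow> real \<Rightarrow> bool" where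
  "proxy_function \<Theta> V \<alpha> \<longleftrightarrow>
     convex_on \<Theta> V \<and> (\<forall>\<theta>\<in>\<Theta>. 0 \<le> V \<theta>) \<and>
     (\<exists>\<theta>s. is_arg_min V (\<lambda>\<theta>. \<theta> \<in> \<Theta>) \<theta>s) \<and>
     assumption_L \<Theta> V \<alpha>"

definition risk ::
    "'w measure \<Rightarrow> ('w \<Rightarrow> 'z) \<Rightarrow> (real ^ 'm \<Rightarrow> 'z \<Rightarrow> real) \<Rightarrow> real ^ 'm \<Rightarrow> real" where
  "risk P Z Q \<theta> = (\<integral>\<omega>. Q \<theta> (Z \<omega>) \<partial>P)"

text \<open>
  The mirror descent recursion along one realisation \<open>u\<close> of the stochastic sub-gradients:
  \<open>md_dual \<dots> i\<close> is \<open>\<zeta>\<^sub>i\<close> and \<open>md_iter \<dots> i\<close> is \<open>\<theta>\<^sub>i\<close>.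
\<close>

fun md_dual :: "(real ^ 'm) set \<Rightarrow> (real ^ 'm \<Rightarrow> real) \<Rightarrow> (nat \<Rightarrow> real) \<Rightarrow> (nat \<Rightarrow> real) \<Rightarrow>
      real ^ 'm \<Rightarrow> (nat \<Rightarrow> real ^ 'm \<Rightarrow> real ^ 'm) \<Rightarrow> nat \<Rightarrow> real ^ 'm"
  and md_iter :: "(real ^ 'm) set \<Rightarrow> (real ^ 'm \<Rightarrow> real) \<Rightarrow> (nat \<Rightarrow> real) \<Rightarrow> (nat \<Rightarrow> real) \<Rightarrow>
      real ^ 'm \<Rightarrow> (nat \<Rightarrow> real ^ 'm \<Rightarrow> real ^ 'm) \<Rightarrow> nat \<Rightarrow> real ^ 'm"
where
  "md_dual \<Theta> V \<gamma> \<beta> \<theta>0 u 0 = 0"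
| "md_dual \<Theta> V \<gamma> \<beta> \<theta>0 u (Suc i) =
     md_dual \<Theta> V \<gamma> \<beta> \<theta>0 u i + \<gamma> (Suc i) *\<^sub>R u (Suc i) (md_iter \<Theta> V \<gamma> \<beta> \<theta>0 u i)"
| "md_iter \<Theta> V \<gamma> \<beta> \<theta>0 u 0 = \<theta>0"
| "md_iter \<Theta> V \<gamma> \<beta> \<theta>0 u (Suc i) =
     - grad (beta_conjugate \<Theta> V (\<beta> (Suc i))) (md_dual \<Theta> V \<gamma> \<beta> \<theta>0 u (Suc i))"

definition md_estimate ::
    "(real ^ 'm) set \<Rightarrow> (real ^ 'm \<Rightarrow> real) \<Rightarrow> (nat \<Rightarrow> real) \<Rightarrow> (nat \<Rightarrow> real) \<Rightarrow>
      real ^ 'm \<Rightarrow> (nat \<Rightarrow> real ^ 'm \<Rightarrow> real ^ 'm) \<Rightarrow> nat \<Rightarrow> real ^ 'm" where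
  "md_estimate \<Theta> V \<gamma> \<beta> \<theta>0 u t =
     (\<Sum>i=1..t. \<gamma> i *\<^sub>R md_iter \<Theta> V \<gamma> \<beta> \<theta>0 u (i - 1)) /\<^sub>R (\<Sum>i=1..t. \<gamma> i)"

end

theory Submission
  imports Defs
begin

text \<open>
  Along every realisation, the potential \<open>W\<^bsub>\<beta>\<^sub>i\<^esub> (\<zeta>\<^sub>i)\<close> decreases with \<open>\<beta>\<^sub>i\<close> (as \<open>V \<ge> 0\<close>), and by the
  Lipschitz gradient condition each dual step raises it by at most
  \<open>- u\<^sub>i \<bullet> \<theta>\<^bsub>i-1\<^esub> + (infnorm u\<^sub>i)\<^sup>2 / (2 \<alpha> \<beta>\<^bsub>i-1\<^esub>)\<close>. Telescoping, and bounding the final potential from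
  below by the definition of the supremum, gives a pathwise regret bound. Taking expectations, with
  \<open>Z\<^sub>i\<close> independent of \<open>\<theta>\<^bsub>i-1\<^esub>\<close>, turns the stochastic sub-gradients into sub-gradients of the risk, and
  \<open>\<Sum>i\<le>t. 1 / sqrt i \<le> 2 * sqrt t\<close> finishes the estimate.
\<close>

section \<open>Regret along a realisation\<close>

lemma GDERIV_unique:
  assumes "GDERIV f x :> a" "GDERIV f x :> b"
  shows "a = b"
proof -
  have "(\<lambda>h. h \<bullet> a) = (\<lambda>h. h \<bullet> b)"
    using assms unfolding gderiv_def by (rule has_derivative_unique)
  then have "h \<bullet> (a - b) = 0" for h
    by (metis inner_diff_right right_minus_eq)
  from this[of "a - b"] show ?thesis by simp
qed

lemma continuously_differentiable_GDERIV_grad: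
  assumes "continuously_differentiable f"
  shows "GDERIV f x :> grad f x"
proof -
  obtain g where "GDERIV f x :> g"
    using assms unfolding continuously_differentiable_def by blast
  then show ?thesis
    unfolding grad_def by (rule theI) (rule GDERIV_unique[OF _ \<open>GDERIV f x :> g\<close>])
qed

lemma GDERIV_imp_has_real_derivative_along:
  assumes "GDERIV f (z + s *\<^sub>R d) :> g"
  shows "((\<lambda>s. f (z + s *\<^sub>R d)) has_real_derivative d \<bullet> g) (at s)"
proof -
  have "((\<lambda>s. z + s *\<^sub>R d) has_derivative (\<lambda>h. h *\<^sub>R d)) (at s)"
    by (auto intro!: derivative_eq_intros)
  moreover have "(f has_derivative (\<lambda>h. h \<bullet> g)) (at (z + s *\<^sub>R d))"
    using assms by (simp add: gderiv_def)
  ultimately have "((\<lambda>s. f (z + s *\<^sub>R d)) has_derivative (\<lambda>h. (h *\<^sub>R d) \<bullet> g)) (at s)"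
    by (rule has_derivative_compose)
  moreover have "(\<lambda>h. (h *\<^sub>R d) \<bullet> g) = (*) (d \<bullet> g)"
    by (simp add: fun_eq_iff)
  ultimately show ?thesis
    by (simp add: has_field_derivative_def)
qed

text \<open>Difference quotients from the right already determine the directional derivative, so a
  linear upper bound along the open ray passes to the limit. The one-sided form suits suprema, whose
  bounds here hold for positive multiples of \<open>d\<close>.\<close>

lemma GDERIV_inner_le:
  assumes "GDERIV f z :> g"
    and "\<And>s. s > 0 \<Longrightarrow> f (z + s *\<^sub>R d) \<le> f z + s * c"
  shows "d \<bullet> g \<le> c"
proof -
  have "((\<lambda>s. f (z + s *\<^sub>R d)) has_real_derivative d \<bullet> g) (at 0)"
    using assms(1) by (intro GDERIV_imp_has_real_derivative_along) simp
  then have "((\<lambda>h. (f (z + h *\<^sub>R d) - f z) / h) \<longlongrightarrow> d \<bullet> g) (at 0)"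
    by (simp add: DERIV_def)
  then have "((\<lambda>h. (f (z + h *\<^sub>R d) - f z) / h) \<longlongrightarrow> d \<bullet> g) (at_right 0)"
    by (rule filterlim_mono) (auto simp: at_le)
  moreover have "\<forall>\<^sub>F h in at_right 0. (f (z + h *\<^sub>R d) - f z) / h \<le> c"
    using assms(2) by (auto simp: eventually_at_filter field_simps intro!: always_eventually)
  ultimately show ?thesis
    by (intro tendsto_upperbound) auto
qed

text \<open>An affine minorant touching \<open>f\<close> at \<open>z\<close> bounds every
  directional derivative from below, by \<open>d \<bullet> p\<close>. Applying the one-sided
  criterion to \<open>- f\<close> and then choosing \<open>d = p - g\<close> makes the squared
  length of \<open>g - p\<close> nonpositive.\<close>

lemma GDERIV_eq_subgradient:
  assumes "GDERIV f z :> g"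
    and "\<And>y. f z + p \<bullet> (y - z) \<le> f y"
  shows "g = p"
proof -
  have neg: "GDERIV (\<lambda>y. - f y) z :> - g"
    using assms(1) by (rule GDERIV_minus)
  have "d \<bullet> - g \<le> d \<bullet> - p" for d
  proof (rule GDERIV_inner_le[OF neg])
    fix s :: real
    show "- f (z + s *\<^sub>R d) \<le> - f z + s * (d \<bullet> - p)"
      using assms(2)[of "z + s *\<^sub>R d"] by (simp add: inner_commute)
  qed
  then have "0 \<le> d \<bullet> (g - p)" for d
    by (simp add: inner_diff_right)
  from this[of "p - g"] have "(g - p) \<bullet> (g - p) \<le> 0"
    by (simp add: inner_diff_left inner_diff_right)
  then have "(g - p) \<bullet> (g - p) = 0"
    by (intro order_antisym inner_ge_zero)
  then show ?thesis by simp
qed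

section \<open>Dual norms and smoothness\<close>

text \<open>Hoelder's inequality for the pair of norms in Assumption (L): it pairs a gradient
  difference, measured by \<open>l1_norm\<close>, with a dual step, measured by
  \<open>infnorm\<close>.\<close>

lemma abs_inner_le_l1_norm_infnorm:
  fixes x y :: "real ^ 'm"
  shows "\<bar>x \<bullet> y\<bar> \<le> l1_norm x * infnorm y"
proof -
  have "\<bar>x \<bullet> y\<bar> \<le> (\<Sum>j\<in>UNIV. \<bar>x $ j\<bar> * \<bar>y $ j\<bar>)"
    unfolding inner_vec_def by (rule order_trans[OF sum_abs]) (simp add: abs_mult)
  also have "\<dots> \<le> (\<Sum>j\<in>UNIV. \<bar>x $ j\<bar> * infnorm y)"
    by (intro sum_mono mult_left_mono component_le_infnorm_cart) auto
  finally show ?thesis by (simp add: l1_norm_def sum_distrib_right)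
qed

lemma norm_le_l1_norm: "norm x \<le> l1_norm x"
  unfolding l1_norm_def by (rule norm_le_l1_cart)

text \<open>The descent lemma. Instead of integrating the gradient along the segment, the defect
  \<open>\<phi>\<close> is shown to be nonincreasing: by Hoelder the gradient change at parameter
  \<open>s\<close> contributes at most \<open>K * s * (infnorm h)\<^sup>2\<close>, the derivative of
  the subtracted quadratic term.\<close>

lemma Lipschitz_gradient_upper_bound:
  fixes W :: "real ^ 'm \<Rightarrow> real"
  assumes "continuously_differentiable W"
    and lip: "\<And>z z'. l1_norm (grad W z - grad W z') \<le> K * infnorm (z - z')"
  shows "W (z + h) \<le> W z + h \<bullet> grad W z + K / 2 * (infnorm h)\<^sup>2"
proof -
  define \<phi> where "\<phi> s = W (z + s *\<^sub>R h) - s * (h \<bullet> grad W z) - K / 2 * s\<^sup>2 * (infnorm h)\<^sup>2" for s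
  have "\<phi> 1 \<le> \<phi> 0"
  proof (rule DERIV_nonpos_imp_nonincreasing[where f = \<phi>])
    fix s :: real
    assume s: "0 \<le> s" "s \<le> 1"
    have "(\<phi> has_real_derivative h \<bullet> grad W (z + s *\<^sub>R h) - h \<bullet> grad W z - K * s * (infnorm h)\<^sup>2) (at s)"
      unfolding \<phi>_def
      by (rule derivative_eq_intros GDERIV_imp_has_real_derivative_along
          continuously_differentiable_GDERIV_grad assms refl)+ simp
    moreover have "h \<bullet> grad W (z + s *\<^sub>R h) - h \<bullet> grad W z \<le> K * s * (infnorm h)\<^sup>2"
    proof -
      have "h \<bullet> grad W (z + s *\<^sub>R h) - h \<bullet> grad W z = (grad W (z + s *\<^sub>R h) - grad W z) \<bullet> h"
        by (simp add: inner_diff_right inner_diff_left inner_commute)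
      also have "\<dots> \<le> l1_norm (grad W (z + s *\<^sub>R h) - grad W z) * infnorm h"
        using abs_inner_le_l1_norm_infnorm abs_le_D1 by blast
      also have "\<dots> \<le> (K * infnorm (s *\<^sub>R h)) * infnorm h"
        using lip[of "z + s *\<^sub>R h" z] by (intro mult_right_mono) (auto simp: infnorm_pos_le)
      finally show ?thesis using s by (simp add: infnorm_mul power2_eq_square mult_ac)
    qed
    ultimately show "\<exists>y. (\<phi> has_real_derivative y) (at s) \<and> y \<le> 0"
      by (auto intro!: exI)
  qed simp
  then show ?thesis by (simp add: \<phi>_def)
qed

section \<open>The conjugate and its gradient\<close>

lemma beta_conjugate_ge:
  assumes "assumption_L \<Theta> V \<alpha>" "\<beta> > 0" "\<theta> \<in> \<Theta>"
  shows "- (z \<bullet> \<theta>) - \<beta> * V \<theta> \<le> beta_conjugate \<Theta> V \<beta> z"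
  unfolding beta_conjugate_def using assms
  by (intro cSUP_upper) (auto simp: assumption_L_def)

lemma beta_conjugate_antimono:
  assumes "assumption_L \<Theta> V \<alpha>" "\<Theta> \<noteq> {}" "\<forall>\<theta>\<in>\<Theta>. 0 \<le> V \<theta>" "0 < \<beta>" "\<beta> \<le> \<beta>'"
  shows "beta_conjugate \<Theta> V \<beta>' z \<le> beta_conjugate \<Theta> V \<beta> z"
  unfolding beta_conjugate_def using assms
  by (intro cSUP_mono) (auto simp: assumption_L_def intro!: bexI mult_right_mono)

lemma beta_conjugate_0:
  assumes "assumption_L \<Theta> V \<alpha>" "\<beta> > 0" "is_arg_min V (\<lambda>\<theta>. \<theta> \<in> \<Theta>) \<theta>0"
  shows "beta_conjugate \<Theta> V \<beta> 0 = - \<beta> * V \<theta>0"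
proof (rule antisym)
  have "\<theta>0 \<in> \<Theta>" "\<And>\<theta>. \<theta> \<in> \<Theta> \<Longrightarrow> V \<theta>0 \<le> V \<theta>"
    using assms(3) by (auto simp: is_arg_min_linorder)
  then show "beta_conjugate \<Theta> V \<beta> 0 \<le> - \<beta> * V \<theta>0"
    unfolding beta_conjugate_def using assms(2) by (intro cSUP_least) auto
  show "- \<beta> * V \<theta>0 \<le> beta_conjugate \<Theta> V \<beta> 0"
    using beta_conjugate_ge[OF assms(1,2) \<open>\<theta>0 \<in> \<Theta>\<close>, of 0] by simp
qed

text \<open>The minimiser of \<open>V\<close> attains the supremum at dual point 0, so it yields an
  affine minorant of the conjugate touching it there; differentiability turns its slope into the
  gradient. Hence the start \<open>\<theta>0\<close> has the same form as all later
  iterates.\<close>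

lemma grad_beta_conjugate_0:
  assumes "assumption_L \<Theta> V \<alpha>" "\<beta> > 0" "is_arg_min V (\<lambda>\<theta>. \<theta> \<in> \<Theta>) \<theta>0"
  shows "grad (beta_conjugate \<Theta> V \<beta>) 0 = - \<theta>0"
proof (rule GDERIV_eq_subgradient)
  show "GDERIV (beta_conjugate \<Theta> V \<beta>) 0 :> grad (beta_conjugate \<Theta> V \<beta>) 0"
    using assms by (intro continuously_differentiable_GDERIV_grad) (auto simp: assumption_L_def)
  fix y
  have "\<theta>0 \<in> \<Theta>" using assms(3) by (simp add: is_arg_min_def)
  then show "beta_conjugate \<Theta> V \<beta> 0 + - \<theta>0 \<bullet> (y - 0) \<le> beta_conjugate \<Theta> V \<beta> y"
    using beta_conjugate_ge[OF assms(1,2), of \<theta>0 y] beta_conjugate_0[OF assms]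
    by (simp add: inner_commute)
qed

text \<open>Otherwise a hyperplane with normal \<open>a\<close> strictly separates the point from
  \<open>\<Theta>\<close>. Moving \<open>z\<close> along \<open>a\<close> lowers every term of the
  supremum at rate at least \<open>b\<close>, so the directional derivative is at most
  \<open>- b\<close>, which contradicts the separation.\<close>

lemma uminus_grad_beta_conjugate_mem:
  assumes "assumption_L \<Theta> V \<alpha>" "\<beta> > 0" "convex \<Theta>" "closed \<Theta>" "\<Theta> \<noteq> {}"
  shows "- grad (beta_conjugate \<Theta> V \<beta>) z \<in> \<Theta>"
proof (rule ccontr)
  define W where "W = beta_conjugate \<Theta> V \<beta>"
  assume "- grad (beta_conjugate \<Theta> V \<beta>) z \<notin> \<Theta>"
  then obtain a b where a: "a \<bullet> - grad W z < b" "\<And>\<theta>. \<theta> \<in> \<Theta> \<Longrightarrow> b < a \<bullet> \<theta>"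
    using separating_hyperplane_closed_point[of \<Theta>] assms(3,4) unfolding W_def by metis
  have "a \<bullet> grad W z \<le> - b"
  proof (rule GDERIV_inner_le)
    show "GDERIV W z :> grad W z"
      using assms unfolding W_def
      by (intro continuously_differentiable_GDERIV_grad) (auto simp: assumption_L_def)
    fix s :: real
    assume "s > 0"
    show "W (z + s *\<^sub>R a) \<le> W z + s * - b"
      \<comment> \<open>Only the conjugate at the shifted point is unfolded; the one at
        \<open>z\<close> stays folded as an upper bound for each of its terms.\<close>
      unfolding W_def beta_conjugate_def[of _ _ _ "z + s *\<^sub>R a"]
    proof (rule cSUP_least)
      fix \<theta> assume "\<theta> \<in> \<Theta>"
      then show "- ((z + s *\<^sub>R a) \<bullet> \<theta>) - \<beta> * V \<theta> \<le> beta_conjugate \<Theta> V \<beta> z + s * - b"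
        using beta_conjugate_ge[OF assms(1,2), of \<theta> z] mult_strict_left_mono[OF a(2) \<open>s > 0\<close>, of \<theta>]
        by (simp add: inner_add_left)
    qed fact
  qed
  with a(1) show False by simp
qed

section \<open>The pathwise regret bound\<close>

lemma md_regret:
  fixes \<theta>0 :: "real ^ 'm" and u :: "nat \<Rightarrow> real ^ 'm \<Rightarrow> real ^ 'm"
  assumes proxy: "proxy_function \<Theta> V \<alpha>" and arg_min: "is_arg_min V (\<lambda>\<theta>. \<theta> \<in> \<Theta>) \<theta>0"
    and \<beta>: "\<And>i. 0 < \<beta> i" "incseq \<beta>" and "\<theta> \<in> \<Theta>"
  defines "x \<equiv> md_iter \<Theta> V (\<lambda>_. 1) \<beta> \<theta>0 u"
  shows "(\<Sum>i<t. u (Suc i) (x i) \<bullet> (x i - \<theta>))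
    \<le> \<beta> t * V \<theta> + (\<Sum>i<t. (infnorm (u (Suc i) (x i)))\<^sup>2 / (2 * \<alpha> * \<beta> i))"
proof -
  define \<zeta> where "\<zeta> = md_dual \<Theta> V (\<lambda>_. 1) \<beta> \<theta>0 u"
  define W where "W = beta_conjugate \<Theta> V"
  have L: "assumption_L \<Theta> V \<alpha>" and V: "\<forall>\<theta>\<in>\<Theta>. 0 \<le> V \<theta>"
    using proxy by (auto simp: proxy_function_def)
  have \<theta>0: "\<theta>0 \<in> \<Theta>" using arg_min by (simp add: is_arg_min_def)
  \<comment> \<open>For a successor this is the recursion itself. For \<open>i = 0\<close> it holds
    because \<zeta> starts at 0 and \<open>\<theta>0\<close> minimises \<open>V\<close>, so the
    telescoping can begin at index 0 with the potential for \<open>\<beta> 0\<close>.\<close>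
  have grad_W: "grad (W (\<beta> i)) (\<zeta> i) = - x i" for i
    by (cases i) (simp_all add: W_def \<zeta>_def x_def grad_beta_conjugate_0[OF L \<beta>(1) arg_min])
  have \<zeta>_Suc: "\<zeta> (Suc i) = \<zeta> i + u (Suc i) (x i)" for i
    by (simp add: \<zeta>_def x_def)
  have step: "W (\<beta> (Suc i)) (\<zeta> (Suc i)) \<le> W (\<beta> i) (\<zeta> i) - u (Suc i) (x i) \<bullet> x i
      + (infnorm (u (Suc i) (x i)))\<^sup>2 / (2 * \<alpha> * \<beta> i)" for i
  proof -
    have "W (\<beta> (Suc i)) (\<zeta> (Suc i)) \<le> W (\<beta> i) (\<zeta> (Suc i))"
      unfolding W_def using \<theta>0 \<beta> V by (intro beta_conjugate_antimono[OF L]) (auto simp: incseq_SucD)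
    also have "\<dots> \<le> W (\<beta> i) (\<zeta> i) + u (Suc i) (x i) \<bullet> grad (W (\<beta> i)) (\<zeta> i)
        + 1 / (\<alpha> * \<beta> i) / 2 * (infnorm (u (Suc i) (x i)))\<^sup>2"
      unfolding \<zeta>_Suc using L \<beta>(1)[of i]
      by (intro Lipschitz_gradient_upper_bound) (auto simp: W_def assumption_L_def)
    finally show ?thesis by (simp add: grad_W mult_ac)
  qed
  have "W (\<beta> t) (\<zeta> t) \<le> W (\<beta> 0) (\<zeta> 0) - (\<Sum>i<t. u (Suc i) (x i) \<bullet> x i)
      + (\<Sum>i<t. (infnorm (u (Suc i) (x i)))\<^sup>2 / (2 * \<alpha> * \<beta> i))" for t
  proof (induction t)
    case (Suc t)
    then show ?case using step[of t] by simp
  qed simp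
  \<comment> \<open>The initial potential equals \<open>- \<beta> 0 * V \<theta>0\<close>.\<close>
  moreover have "W (\<beta> 0) (\<zeta> 0) \<le> 0"
    using V \<theta>0 \<beta>(1)[of 0] by (simp add: W_def \<zeta>_def beta_conjugate_0[OF L \<beta>(1) arg_min])
  moreover have "- (\<zeta> t \<bullet> \<theta>) - \<beta> t * V \<theta> \<le> W (\<beta> t) (\<zeta> t)"
    unfolding W_def by (rule beta_conjugate_ge[OF L \<beta>(1) \<open>\<theta> \<in> \<Theta>\<close>])
  \<comment> \<open>Thus \<open>- (\<zeta> t \<bullet> \<theta>)\<close> in the lower bound on the
    final potential is the comparator part of the regret.\<close>
  moreover have "\<zeta> t = (\<Sum>i<t. u (Suc i) (x i))" for t
    by (induction t) (simp_all add: \<zeta>_Suc, simp add: \<zeta>_def)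
  ultimately show ?thesis
    by (simp add: inner_diff_right sum_subtractf inner_sum_left) (smt (verit))
qed

section \<open>Expectation over independent observations\<close>

lemma integrable_norm_power2_add:
  fixes f g :: "'a \<Rightarrow> 'b::euclidean_space"
  assumes [measurable]: "f \<in> borel_measurable M" "g \<in> borel_measurable M"
    and "integrable M (\<lambda>x. (norm (f x))\<^sup>2)" "integrable M (\<lambda>x. (norm (g x))\<^sup>2)"
  shows "integrable M (\<lambda>x. (norm (f x + g x))\<^sup>2)"
proof (rule Bochner_Integration.integrable_bound)
  show "integrable M (\<lambda>x. 2 * (norm (f x))\<^sup>2 + 2 * (norm (g x))\<^sup>2)"
    using assms by simp
  have "(norm (f x + g x))\<^sup>2 \<le> 2 * (norm (f x))\<^sup>2 + 2 * (norm (g x))\<^sup>2" for x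
  proof -
    have "(norm (f x + g x))\<^sup>2 \<le> (norm (f x) + norm (g x))\<^sup>2"
      by (intro power_mono norm_triangle_ineq) auto
    also have "\<dots> \<le> 2 * (norm (f x))\<^sup>2 + 2 * (norm (g x))\<^sup>2"
      using zero_le_power2[of "norm (f x) - norm (g x)"] by (simp add: power2_sum power2_diff)
    finally show ?thesis .
  qed
  then show "AE x in M. norm ((norm (f x + g x))\<^sup>2) \<le> norm (2 * (norm (f x))\<^sup>2 + 2 * (norm (g x))\<^sup>2)"
    by (intro AE_I2) (simp add: abs_le_iff)
qed measurable

lemma integrable_inner_of_norm_power2:
  fixes f g :: "'a \<Rightarrow> 'b::euclidean_space"
  assumes [measurable]: "f \<in> borel_measurable M" "g \<in> borel_measurable M"
    and "integrable M (\<lambda>x. (norm (f x))\<^sup>2)" "integrable M (\<lambda>x. (norm (g x))\<^sup>2)"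
  shows "integrable M (\<lambda>x. f x \<bullet> g x)"
proof (rule Bochner_Integration.integrable_bound)
  show "integrable M (\<lambda>x. (norm (f x))\<^sup>2 + (norm (g x))\<^sup>2)"
    using assms by simp
  have "\<bar>f x \<bullet> g x\<bar> \<le> (norm (f x))\<^sup>2 + (norm (g x))\<^sup>2" for x
  proof -
    have "\<bar>f x \<bullet> g x\<bar> \<le> norm (f x) * norm (g x)"
      by (rule Cauchy_Schwarz_ineq2)
    also have "\<dots> \<le> (norm (f x))\<^sup>2 + (norm (g x))\<^sup>2"
      using zero_le_power2[of "norm (f x) - norm (g x)"] mult_nonneg_nonneg[OF norm_ge_zero norm_ge_zero, of "f x" "g x"]
      unfolding power2_diff by linarith
    finally show ?thesis .
  qed
  then show "AE x in M. norm (f x \<bullet> g x) \<le> norm ((norm (f x))\<^sup>2 + (norm (g x))\<^sup>2)"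
    by (intro AE_I2) (simp add: abs_le_iff)
qed measurable

lemma borel_measurable_infnorm [measurable]:
  "infnorm \<in> borel_measurable (borel :: 'a::euclidean_space measure)"
  by (intro borel_measurable_continuous_onI continuous_on_infnorm continuous_on_id)

section \<open>The random recursion and its measurability\<close>

text \<open>The recursion is adapted: stage \<open>i\<close> reads only the first \<open>i\<close>
  observations. This allows an iterate to be recomputed from the past block alone in the
  independence argument.\<close>

lemma md_cong:
  assumes "\<And>j. 1 \<le> j \<Longrightarrow> j \<le> i \<Longrightarrow> u j = u' j"
  shows "md_dual \<Theta> V \<gamma> \<beta> \<theta>0 u i = md_dual \<Theta> V \<gamma> \<beta> \<theta>0 u' i"
    and "md_iter \<Theta> V \<gamma> \<beta> \<theta>0 u i = md_iter \<Theta> V \<gamma> \<beta> \<theta>0 u' i"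
proof -
  have "md_dual \<Theta> V \<gamma> \<beta> \<theta>0 u i = md_dual \<Theta> V \<gamma> \<beta> \<theta>0 u' i \<and>
    md_iter \<Theta> V \<gamma> \<beta> \<theta>0 u i = md_iter \<Theta> V \<gamma> \<beta> \<theta>0 u' i"
    using assms
  proof (induction i)
    case (Suc i)
    have "md_dual \<Theta> V \<gamma> \<beta> \<theta>0 u (Suc i) = md_dual \<Theta> V \<gamma> \<beta> \<theta>0 u' (Suc i)"
      using Suc.IH Suc.prems by simp
    then show ?case by simp
  qed simp
  then show "md_dual \<Theta> V \<gamma> \<beta> \<theta>0 u i = md_dual \<Theta> V \<gamma> \<beta> \<theta>0 u' i"
    and "md_iter \<Theta> V \<gamma> \<beta> \<theta>0 u i = md_iter \<Theta> V \<gamma> \<beta> \<theta>0 u' i" by auto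
qed

text \<open>The risk enters as an abstract \<open>A\<close>, tied to \<open>gradQ\<close> only
  through unbiasedness, and the schedule \<beta> is any positive nondecreasing sequence. The moment
  bound is a nonnegative integral, so that it carries integrability with it.\<close>

locale stochastic_mirror_descent = prob_space P for P :: "'w measure" +
  fixes \<Theta> :: "(real ^ 'm) set" and S :: "'z measure" and Zs :: "nat \<Rightarrow> 'w \<Rightarrow> 'z"
    and gradQ :: "real ^ 'm \<Rightarrow> 'z \<Rightarrow> real ^ 'm" and V A :: "real ^ 'm \<Rightarrow> real"
    and L \<alpha> :: real and \<theta>0 :: "real ^ 'm" and \<beta> :: "nat \<Rightarrow> real"
  assumes convex_\<Theta>: "convex \<Theta>" and closed_\<Theta>: "closed \<Theta>"
    and indep: "indep_vars (\<lambda>_. S) Zs {1..}"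
    and gradQ_measurable:
      "(\<lambda>(\<theta>, z). gradQ \<theta> z) \<in> borel_measurable (restrict_space borel \<Theta> \<Otimes>\<^sub>M S)"
    and gradQ_integrable: "\<theta> \<in> \<Theta> \<Longrightarrow> 1 \<le> i \<Longrightarrow> integrable P (\<lambda>\<omega>. gradQ \<theta> (Zs i \<omega>))"
    and gradQ_unbiased:
      "\<theta> \<in> \<Theta> \<Longrightarrow> 1 \<le> i \<Longrightarrow> (\<integral>\<omega>. gradQ \<theta> (Zs i \<omega>) \<partial>P) \<in> subdifferential \<Theta> A \<theta>"
    and gradQ_moment:
      "\<theta> \<in> \<Theta> \<Longrightarrow> 1 \<le> i \<Longrightarrow>
        (\<integral>\<^sup>+\<omega>. ennreal ((infnorm (gradQ \<theta> (Zs i \<omega>)))\<^sup>2) \<partial>P) \<le> ennreal (L\<^sup>2)"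
    and \<alpha>_pos: "0 < \<alpha>" and proxy: "proxy_function \<Theta> V \<alpha>"
    and \<theta>0: "is_arg_min V (\<lambda>\<theta>. \<theta> \<in> \<Theta>) \<theta>0"
    and \<beta>_pos: "0 < \<beta> i" and \<beta>_mono: "incseq \<beta>"
begin

text \<open>The measurability of \<open>gradQ\<close> is assumed over \<open>\<Theta>\<close> only,
  so iterates have to be measurable into this restricted space before they can be plugged
  in.\<close>

abbreviation B\<Theta> :: "(real ^ 'm) measure" where
  "B\<Theta> \<equiv> restrict_space borel \<Theta>"

definition dual :: "nat \<Rightarrow> 'w \<Rightarrow> real ^ 'm" where
  "dual i \<omega> = md_dual \<Theta> V (\<lambda>_. 1) \<beta> \<theta>0 (\<lambda>i \<theta>. gradQ \<theta> (Zs i \<omega>)) i"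

definition iterate :: "nat \<Rightarrow> 'w \<Rightarrow> real ^ 'm" where
  "iterate i \<omega> = md_iter \<Theta> V (\<lambda>_. 1) \<beta> \<theta>0 (\<lambda>i \<theta>. gradQ \<theta> (Zs i \<omega>)) i"

definition subgradient :: "nat \<Rightarrow> 'w \<Rightarrow> real ^ 'm" where
  "subgradient i \<omega> = gradQ (iterate i \<omega>) (Zs (Suc i) \<omega>)"

lemma dual_Suc: "dual (Suc i) \<omega> = dual i \<omega> + subgradient i \<omega>"
  by (simp add: dual_def iterate_def subgradient_def)

lemma assumption_L: "assumption_L \<Theta> V \<alpha>"
  using proxy by (simp add: proxy_function_def)

lemma \<theta>0_mem: "\<theta>0 \<in> \<Theta>"
  using \<theta>0 by (simp add: is_arg_min_def)

lemma space_B\<Theta> [simp]: "space B\<Theta> = \<Theta>"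
  by (simp add: space_restrict_space)

lemma measurable_B\<Theta>I:
  "f \<in> borel_measurable N \<Longrightarrow> (\<And>x. x \<in> space N \<Longrightarrow> f x \<in> \<Theta>) \<Longrightarrow> f \<in> measurable N B\<Theta>"
  by (intro measurable_restrict_space2) auto

lemma borel_measurable_B\<Theta>: "f \<in> measurable N B\<Theta> \<Longrightarrow> f \<in> borel_measurable N"
  by (simp add: measurable_restrict_space2_iff)

lemma Zs_measurable: "1 \<le> i \<Longrightarrow> Zs i \<in> measurable P S"
  using indep by (simp add: indep_vars_def)

lemma gradQ_compose_measurable:
  assumes "f \<in> measurable N B\<Theta>" "g \<in> measurable N S"
  shows "(\<lambda>x. gradQ (f x) (g x)) \<in> borel_measurable N"
  using measurable_compose[OF measurable_Pair[OF assms] gradQ_measurable] by simp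

lemma md_iter_mem: "md_iter \<Theta> V \<gamma> \<beta> \<theta>0 u i \<in> \<Theta>"
  using \<theta>0_mem convex_\<Theta> closed_\<Theta> \<beta>_pos
  by (cases i) (auto intro!: uminus_grad_beta_conjugate_mem[OF assumption_L])

lemma iterate_mem: "iterate i \<omega> \<in> \<Theta>"
  unfolding iterate_def by (rule md_iter_mem)

text \<open>Stated for arbitrary observations \<open>x\<close> on an arbitrary space, as it serves
  both the actual observations on \<open>P\<close> and the coordinate maps on the product space of
  past observations. The mirror map is Borel because Assumption (L) makes the gradient
  continuous.\<close>

lemma md_measurable:
  assumes "\<And>j. 1 \<le> j \<Longrightarrow> j \<le> i \<Longrightarrow> x j \<in> measurable N S"
  shows "(\<lambda>\<omega>. md_dual \<Theta> V (\<lambda>_. 1) \<beta> \<theta>0 (\<lambda>j \<theta>. gradQ \<theta> (x j \<omega>)) i) \<in> borel_measurable N"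
    and "(\<lambda>\<omega>. md_iter \<Theta> V (\<lambda>_. 1) \<beta> \<theta>0 (\<lambda>j \<theta>. gradQ \<theta> (x j \<omega>)) i) \<in> measurable N B\<Theta>"
proof -
  let ?\<zeta> = "\<lambda>i \<omega>. md_dual \<Theta> V (\<lambda>_. 1) \<beta> \<theta>0 (\<lambda>j \<theta>. gradQ \<theta> (x j \<omega>)) i"
  let ?\<theta> = "\<lambda>i \<omega>. md_iter \<Theta> V (\<lambda>_. 1) \<beta> \<theta>0 (\<lambda>j \<theta>. gradQ \<theta> (x j \<omega>)) i"
  have "?\<zeta> i \<in> borel_measurable N \<and> ?\<theta> i \<in> measurable N B\<Theta>"
    using assms
  proof (induction i)
    case 0
    then show ?case using \<theta>0_mem by (auto intro!: measurable_B\<Theta>I)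
  next
    case (Suc i)
    then have *[measurable]: "?\<zeta> i \<in> borel_measurable N"
      and "?\<theta> i \<in> measurable N B\<Theta>" "x (Suc i) \<in> measurable N S" by auto
    then have [measurable]: "(\<lambda>\<omega>. gradQ (?\<theta> i \<omega>) (x (Suc i) \<omega>)) \<in> borel_measurable N"
      by (intro gradQ_compose_measurable)
    have \<zeta>: "?\<zeta> (Suc i) \<in> borel_measurable N"
      by simp
    have "continuous_on UNIV (grad (beta_conjugate \<Theta> V (\<beta> (Suc i))))"
      using assumption_L \<beta>_pos by (auto simp: assumption_L_def continuously_differentiable_def)
    then have "grad (beta_conjugate \<Theta> V (\<beta> (Suc i))) \<in> borel_measurable borel"
      by (rule borel_measurable_continuous_onI)
    from measurable_compose[OF \<zeta> this] have "?\<theta> (Suc i) \<in> borel_measurable N"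
      by simp
    then show ?case
      using \<zeta> md_iter_mem by (blast intro: measurable_B\<Theta>I)
  qed
  then show "?\<zeta> i \<in> borel_measurable N" "?\<theta> i \<in> measurable N B\<Theta>" by auto
qed

lemma dual_measurable [measurable]: "dual i \<in> borel_measurable P"
  unfolding dual_def[abs_def] by (intro md_measurable Zs_measurable)

lemma iterate_measurable: "iterate i \<in> measurable P B\<Theta>"
  unfolding iterate_def[abs_def] by (intro md_measurable Zs_measurable)

lemma iterate_borel_measurable [measurable]: "iterate i \<in> borel_measurable P"
  by (rule borel_measurable_B\<Theta>[OF iterate_measurable])

lemma subgradient_measurable [measurable]: "subgradient i \<in> borel_measurable P"
  unfolding subgradient_def[abs_def]
  by (intro gradQ_compose_measurable iterate_measurable Zs_measurable) simp

section \<open>Independence of the iterate and the next observation\<close>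

text \<open>The iterate is a measurable function of observations 1 to \<open>i\<close>, and the next
  observation is a coordinate of a disjoint block. Independent blocks have a product law, and its
  image under a product map is again a product.\<close>

lemma distr_iterate_Zs:
  "distr P (B\<Theta> \<Otimes>\<^sub>M S) (\<lambda>\<omega>. (iterate i \<omega>, Zs (Suc i) \<omega>))
    = distr P B\<Theta> (iterate i) \<Otimes>\<^sub>M distr P S (Zs (Suc i))"
proof -
  let ?F = "\<lambda>x. md_iter \<Theta> V (\<lambda>_. 1) \<beta> \<theta>0 (\<lambda>j \<theta>. gradQ \<theta> (x j)) i"
  \<comment> \<open>For \<open>i = 0\<close> the past block is empty and the iterate is the constant
    \<open>\<theta>0\<close>.\<close>
  let ?past = "\<lambda>\<omega>. \<lambda>j\<in>{Suc 0..i}. Zs j \<omega>" and ?next = "\<lambda>\<omega>. \<lambda>j\<in>{Suc i}. Zs j \<omega>"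
  let ?N = "PiM {Suc 0..i} (\<lambda>_. S)" and ?N' = "PiM {Suc i} (\<lambda>_. S)"
  have "indep_var ?N ?past ?N' ?next"
    by (rule indep_var_restrict[OF indep]) auto
  then have [measurable]: "?past \<in> measurable P ?N" "?next \<in> measurable P ?N'"
    and eq: "distr P ?N ?past \<Otimes>\<^sub>M distr P ?N' ?next
      = distr P (?N \<Otimes>\<^sub>M ?N') (\<lambda>\<omega>. (?past \<omega>, ?next \<omega>))"
    unfolding indep_var_distribution_eq by simp_all
  have [measurable]: "?F \<in> measurable ?N B\<Theta>" "(\<lambda>x. x (Suc i)) \<in> measurable ?N' S"
    by (auto intro!: md_measurable)
  \<comment> \<open>The restricted family agrees with the observations at every index that the
    recursion reads.\<close>
  have F: "?F (?past \<omega>) = iterate i \<omega>" for \<omega>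
    unfolding iterate_def by (intro md_cong) (auto simp: fun_eq_iff)
  interpret Y: prob_space "distr (distr P ?N' ?next) S (\<lambda>x. x (Suc i))"
    by (intro prob_space.prob_space_distr prob_space_distr) simp_all
  have "distr P B\<Theta> (iterate i) \<Otimes>\<^sub>M distr P S (Zs (Suc i)) =
      distr (distr P ?N ?past) B\<Theta> ?F \<Otimes>\<^sub>M distr (distr P ?N' ?next) S (\<lambda>x. x (Suc i))"
    by (subst (1 2) distr_distr) (simp_all only: comp_def F, simp_all)
  also have "\<dots> = distr (distr P ?N ?past \<Otimes>\<^sub>M distr P ?N' ?next) (B\<Theta> \<Otimes>\<^sub>M S) (\<lambda>(x, y). (?F x, y (Suc i)))"
    by (intro pair_measure_distr Y.sigma_finite_measure_axioms) simp_all
  also have "\<dots> = distr P (B\<Theta> \<Otimes>\<^sub>M S) (\<lambda>\<omega>. (iterate i \<omega>, Zs (Suc i) \<omega>))"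
    unfolding eq by (subst distr_distr) (simp_all only: comp_def F case_prod_conv, measurable)
  finally show ?thesis by (rule sym)
qed

lemma gradQ_infnorm_measurable:
  "(\<lambda>(\<theta>, z). ennreal ((infnorm (gradQ \<theta> z))\<^sup>2)) \<in> borel_measurable (B\<Theta> \<Otimes>\<^sub>M S)"
  using measurable_compose[OF gradQ_measurable, of "\<lambda>g. ennreal ((infnorm g)\<^sup>2)" borel]
  by (simp add: case_prod_beta')

text \<open>By Tonelli on the product law, the iterate can be frozen while the next observation is
  integrated out. The moment bound holds at each fixed point of \<open>\<Theta>\<close>, hence also
  after averaging over the law of the iterate.\<close>

lemma subgradient_moment:
  "(\<integral>\<^sup>+\<omega>. ennreal ((infnorm (subgradient i \<omega>))\<^sup>2) \<partial>P) \<le> ennreal (L\<^sup>2)"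
proof -
  define X where "X = distr P B\<Theta> (iterate i)"
  define Y where "Y = distr P S (Zs (Suc i))"
  have Zm [measurable]: "Zs (Suc i) \<in> measurable P S" by (intro Zs_measurable) simp
  note iterate_measurable [measurable] gradQ_infnorm_measurable [measurable]
  interpret X: prob_space X unfolding X_def by (rule prob_space_distr) measurable
  interpret Y: prob_space Y unfolding Y_def by (rule prob_space_distr) measurable
  let ?f = "\<lambda>(\<theta>, z). ennreal ((infnorm (gradQ \<theta> z))\<^sup>2)"
  have f [measurable]: "?f \<in> borel_measurable (X \<Otimes>\<^sub>M Y)"
    using gradQ_infnorm_measurable unfolding X_def Y_def by simp
  have "(\<integral>\<^sup>+\<omega>. ennreal ((infnorm (subgradient i \<omega>))\<^sup>2) \<partial>P) =
      (\<integral>\<^sup>+x. ?f x \<partial>distr P (B\<Theta> \<Otimes>\<^sub>M S) (\<lambda>\<omega>. (iterate i \<omega>, Zs (Suc i) \<omega>)))"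
    by (subst nn_integral_distr) (simp_all add: subgradient_def)
  also have "\<dots> = (\<integral>\<^sup>+\<theta>. \<integral>\<^sup>+z. ?f (\<theta>, z) \<partial>Y \<partial>X)"
    unfolding distr_iterate_Zs X_def[symmetric] Y_def[symmetric]
    by (rule Y.nn_integral_fst[symmetric]) fact
  also have "\<dots> \<le> (\<integral>\<^sup>+\<theta>. ennreal (L\<^sup>2) \<partial>X)"
  proof (rule nn_integral_mono)
    fix \<theta> assume "\<theta> \<in> space X"
    then have \<theta>: "\<theta> \<in> \<Theta>" by (simp add: X_def)
    have "(\<lambda>z. ?f (\<theta>, z)) \<in> borel_measurable S"
      using measurable_compose[OF measurable_Pair1' gradQ_infnorm_measurable] \<theta> by simp
    then have "(\<integral>\<^sup>+z. ?f (\<theta>, z) \<partial>Y) = (\<integral>\<^sup>+\<omega>. ennreal ((infnorm (gradQ \<theta> (Zs (Suc i) \<omega>)))\<^sup>2) \<partial>P)"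
      unfolding Y_def by (subst nn_integral_distr) simp_all
    also have "\<dots> \<le> ennreal (L\<^sup>2)" using \<theta> by (intro gradQ_moment) simp_all
    finally show "(\<integral>\<^sup>+z. ?f (\<theta>, z) \<partial>Y) \<le> ennreal (L\<^sup>2)" .
  qed
  also have "\<dots> = ennreal (L\<^sup>2)" by (simp add: X.emeasure_space_1)
  finally show ?thesis .
qed

section \<open>Square integrability of sub-gradients and iterates\<close>

lemma integrable_of_moment:
  assumes [measurable]: "f \<in> borel_measurable P"
    and "(\<integral>\<^sup>+\<omega>. ennreal ((infnorm (f \<omega>))\<^sup>2) \<partial>P) \<le> ennreal (L\<^sup>2)"
  shows "integrable P (\<lambda>\<omega>. (infnorm (f \<omega>))\<^sup>2)" "(\<integral>\<omega>. (infnorm (f \<omega>))\<^sup>2 \<partial>P) \<le> L\<^sup>2"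
proof -
  show *: "integrable P (\<lambda>\<omega>. (infnorm (f \<omega>))\<^sup>2)"
  proof (rule integrableI_bounded)
    show "(\<integral>\<^sup>+\<omega>. ennreal (norm ((infnorm (f \<omega>))\<^sup>2)) \<partial>P) < \<infinity>"
      using assms(2) by (simp add: le_less_trans[OF _ ennreal_less_top])
  qed measurable
  show "(\<integral>\<omega>. (infnorm (f \<omega>))\<^sup>2 \<partial>P) \<le> L\<^sup>2"
    using assms(2) by (subst (asm) nn_integral_eq_integral[OF *]) auto
qed

lemma norm_power2_le_infnorm:
  fixes x :: "real ^ 'm"
  shows "(norm x)\<^sup>2 \<le> CARD('m) * (infnorm x)\<^sup>2"
proof -
  have "(norm x)\<^sup>2 \<le> (sqrt DIM(real ^ 'm) * infnorm x)\<^sup>2"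
    by (intro power_mono norm_le_infnorm) auto
  then show ?thesis by (simp add: power_mult_distrib)
qed

lemma subgradient_norm_power2_integrable: "integrable P (\<lambda>\<omega>. (norm (subgradient i \<omega>))\<^sup>2)"
proof (rule Bochner_Integration.integrable_bound)
  show "integrable P (\<lambda>\<omega>. CARD('m) * (infnorm (subgradient i \<omega>))\<^sup>2)"
    using integrable_of_moment(1)[OF subgradient_measurable subgradient_moment] by simp
qed (use norm_power2_le_infnorm in \<open>auto simp: abs_mult\<close>)

lemma dual_norm_power2_integrable: "integrable P (\<lambda>\<omega>. (norm (dual i \<omega>))\<^sup>2)"
proof (induction i)
  case (Suc i)
  then show ?case
    unfolding dual_Suc by (intro integrable_norm_power2_add subgradient_norm_power2_integrable) auto
qed (simp add: dual_def)

text \<open>The Lipschitz condition is applied between the dual point and 0, where the gradient is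
  \<open>- \<theta>0\<close>. This makes the iterates square integrable even when
  \<open>\<Theta>\<close> is unbounded.\<close>

lemma norm_iterate_Suc_le: "norm (iterate (Suc i) \<omega> - \<theta>0) \<le> norm (dual (Suc i) \<omega>) / (\<alpha> * \<beta> (Suc i))"
proof -
  let ?W = "beta_conjugate \<Theta> V (\<beta> (Suc i))"
  have "iterate (Suc i) \<omega> = - grad ?W (dual (Suc i) \<omega>)"
    unfolding iterate_def dual_def by (rule md_iter.simps)
  then have "norm (iterate (Suc i) \<omega> - \<theta>0) = norm (grad ?W (dual (Suc i) \<omega>) - grad ?W 0)"
    using norm_minus_cancel[of "grad ?W (dual (Suc i) \<omega>) + \<theta>0"]
    by (simp add: grad_beta_conjugate_0[OF assumption_L \<beta>_pos \<theta>0])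
  also have "\<dots> \<le> l1_norm (grad ?W (dual (Suc i) \<omega>) - grad ?W 0)"
    by (rule norm_le_l1_norm)
  also have "\<dots> \<le> 1 / (\<alpha> * \<beta> (Suc i)) * infnorm (dual (Suc i) \<omega> - 0)"
    using assumption_L \<beta>_pos unfolding assumption_L_def by blast
  also have "\<dots> \<le> 1 / (\<alpha> * \<beta> (Suc i)) * norm (dual (Suc i) \<omega>)"
    using \<alpha>_pos \<beta>_pos[of "Suc i"] by (intro mult_left_mono) (auto simp: infnorm_le_norm)
  finally show ?thesis by simp
qed

lemma iterate_norm_power2_integrable: "integrable P (\<lambda>\<omega>. (norm (iterate i \<omega> - \<theta>))\<^sup>2)"
proof -
  have "integrable P (\<lambda>\<omega>. (norm (iterate i \<omega> - \<theta>0))\<^sup>2)"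
  proof (cases i)
    case (Suc k)
    show ?thesis
    proof (rule Bochner_Integration.integrable_bound)
      show "integrable P (\<lambda>\<omega>. (norm (dual (Suc k) \<omega>))\<^sup>2 / (\<alpha> * \<beta> (Suc k))\<^sup>2)"
        using dual_norm_power2_integrable by simp
      show "AE \<omega> in P. norm ((norm (iterate i \<omega> - \<theta>0))\<^sup>2)
          \<le> norm ((norm (dual (Suc k) \<omega>))\<^sup>2 / (\<alpha> * \<beta> (Suc k))\<^sup>2)"
        using power_mono[OF norm_iterate_Suc_le norm_ge_zero, of _ _ 2] Suc
        by (auto simp: power_divide)
    qed measurable
  qed (simp add: iterate_def)
  then have "integrable P (\<lambda>\<omega>. (norm ((iterate i \<omega> - \<theta>0) + (\<theta>0 - \<theta>)))\<^sup>2)"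
    by (intro integrable_norm_power2_add) auto
  then show ?thesis by simp
qed

section \<open>Regularity of the risk\<close>

text \<open>The mean of the stochastic sub-gradient is itself a sub-gradient of \<open>A\<close>,
  and the second moment bounds its length uniformly over \<open>\<Theta>\<close>. The constant
  \<open>1 + CARD('m) * L\<^sup>2\<close> comes from bounding a length by 1 plus its square and
  comparing the Euclidean with the maximum norm.\<close>

lemma subgradients_bounded:
  obtains C where "\<And>\<theta>. \<theta> \<in> \<Theta> \<Longrightarrow> \<exists>g\<in>subdifferential \<Theta> A \<theta>. norm g \<le> C"
proof
  fix \<theta> assume \<theta>: "\<theta> \<in> \<Theta>"
  define f where "f \<omega> = gradQ \<theta> (Zs 1 \<omega>)" for \<omega>
  have f: "integrable P f" using \<theta> unfolding f_def by (intro gradQ_integrable) auto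
  then have [measurable]: "f \<in> borel_measurable P" by auto
  have moment: "integrable P (\<lambda>\<omega>. (infnorm (f \<omega>))\<^sup>2)" "(\<integral>\<omega>. (infnorm (f \<omega>))\<^sup>2 \<partial>P) \<le> L\<^sup>2"
    using gradQ_moment[OF \<theta>, of 1]
    by (intro integrable_of_moment \<open>f \<in> borel_measurable P\<close>; simp add: f_def)+
  have "norm (\<integral>\<omega>. f \<omega> \<partial>P) \<le> (\<integral>\<omega>. norm (f \<omega>) \<partial>P)"
    by (rule integral_norm_bound)
  also have "\<dots> \<le> (\<integral>\<omega>. 1 + CARD('m) * (infnorm (f \<omega>))\<^sup>2 \<partial>P)"
  proof (rule integral_mono)
    fix \<omega>
    have "norm (f \<omega>) \<le> 1 + (norm (f \<omega>))\<^sup>2"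
      using zero_le_power2[of "norm (f \<omega>) - 1"] norm_ge_zero[of "f \<omega>"]
      unfolding power2_diff power_one by linarith
    then show "norm (f \<omega>) \<le> 1 + CARD('m) * (infnorm (f \<omega>))\<^sup>2"
      using norm_power2_le_infnorm[of "f \<omega>"] by linarith
  qed (use f moment in auto)
  also have "\<dots> = 1 + CARD('m) * (\<integral>\<omega>. (infnorm (f \<omega>))\<^sup>2 \<partial>P)"
    using moment by (simp add: prob_space)
  also have "\<dots> \<le> 1 + CARD('m) * L\<^sup>2"
    using moment by (intro add_left_mono mult_left_mono) auto
  finally show "\<exists>g\<in>subdifferential \<Theta> A \<theta>. norm g \<le> 1 + CARD('m) * L\<^sup>2"
    using gradQ_unbiased[OF \<theta>, of 1] by (auto simp: f_def)
qed

text \<open>Bounded sub-gradients at both endpoints control the difference of \<open>A\<close> in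
  either direction. Continuity then makes \<open>A\<close> measurable on \<open>\<Theta>\<close>,
  and linear growth makes it integrable along integrable random points.\<close>

lemma risk_lipschitz: obtains C where "C-lipschitz_on \<Theta> A"
proof -
  obtain C where C: "\<And>\<theta>. \<theta> \<in> \<Theta> \<Longrightarrow> \<exists>g\<in>subdifferential \<Theta> A \<theta>. norm g \<le> C"
    using subgradients_bounded by blast
  have *: "A x - A y \<le> C * norm (x - y)" if xy: "x \<in> \<Theta>" "y \<in> \<Theta>" for x y
  proof -
    obtain g where g: "g \<in> subdifferential \<Theta> A x" "norm g \<le> C" using C xy by blast
    have "A x - A y \<le> g \<bullet> (x - y)"
      using g(1) xy by (auto simp: subdifferential_def inner_diff_right algebra_simps)
    also have "\<dots> \<le> norm g * norm (x - y)" by (rule norm_cauchy_schwarz)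
    also have "\<dots> \<le> C * norm (x - y)" using g(2) by (intro mult_right_mono) auto
    finally show ?thesis .
  qed
  have "C-lipschitz_on \<Theta> A"
  proof (rule lipschitz_onI)
    show "0 \<le> C" using C[OF \<theta>0_mem] norm_ge_zero order_trans by blast
    show "dist (A x) (A y) \<le> C * dist x y" if "x \<in> \<Theta>" "y \<in> \<Theta>" for x y
      using *[OF that] *[OF that(2,1)] by (simp add: dist_norm norm_minus_commute abs_le_iff)
  qed
  then show ?thesis by (rule that)
qed

lemma integrable_risk_compose:
  assumes X: "X \<in> borel_measurable P" "\<And>\<omega>. X \<omega> \<in> \<Theta>" and "integrable P X"
  shows "integrable P (\<lambda>\<omega>. A (X \<omega>))"
proof -
  obtain C where C: "C-lipschitz_on \<Theta> A" by (rule risk_lipschitz)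
  have "A \<in> borel_measurable B\<Theta>"
    using lipschitz_on_continuous_on[OF C] by (rule borel_measurable_continuous_on_restrict)
  moreover have "X \<in> measurable P B\<Theta>" using X by (intro measurable_B\<Theta>I)
  ultimately have meas: "(\<lambda>\<omega>. A (X \<omega>)) \<in> borel_measurable P"
    by (rule measurable_compose[rotated])
  show ?thesis
  proof (rule Bochner_Integration.integrable_bound)
    show "integrable P (\<lambda>\<omega>. \<bar>A \<theta>0\<bar> + C * norm (X \<omega> - \<theta>0))"
      using assms by simp
    show "AE \<omega> in P. norm (A (X \<omega>)) \<le> norm (\<bar>A \<theta>0\<bar> + C * norm (X \<omega> - \<theta>0))"
    proof (intro AE_I2)
      fix \<omega>
      show "norm (A (X \<omega>)) \<le> norm (\<bar>A \<theta>0\<bar> + C * norm (X \<omega> - \<theta>0))"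
        using lipschitz_onD[OF C X(2) \<theta>0_mem, of \<omega>] by (simp add: dist_norm)
    qed
  qed fact
qed

lemma iterate_integrable: "integrable P (iterate i)"
proof -
  have "integrable P (\<lambda>\<omega>. (norm (iterate i \<omega>))\<^sup>2)"
    using iterate_norm_power2_integrable[of i 0] by simp
  then have "integrable P (\<lambda>\<omega>. norm (iterate i \<omega>))"
    by (rule square_integrable_imp_integrable[rotated]) measurable
  then show ?thesis by (subst (asm) integrable_norm_iff) simp_all
qed

lemma subgradient_inner_integrable: "integrable P (\<lambda>\<omega>. subgradient i \<omega> \<bullet> (iterate i \<omega> - \<theta>))"
  by (intro integrable_inner_of_norm_power2 subgradient_norm_power2_integrable
      iterate_norm_power2_integrable) measurable

text \<open>Since the next observation is independent of the current iterate, integrating it out first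
  replaces the stochastic sub-gradient by a true one.\<close>

lemma expected_risk_iterate_le:
  assumes "\<theta> \<in> \<Theta>"
  shows "(\<integral>\<omega>. A (iterate i \<omega>) \<partial>P) - A \<theta> \<le> (\<integral>\<omega>. subgradient i \<omega> \<bullet> (iterate i \<omega> - \<theta>) \<partial>P)"
proof -
  define X where "X = distr P B\<Theta> (iterate i)"
  define Y where "Y = distr P S (Zs (Suc i))"
  have Zm [measurable]: "Zs (Suc i) \<in> measurable P S" by (intro Zs_measurable) simp
  note iterate_measurable [measurable]
  interpret X: prob_space X unfolding X_def by (rule prob_space_distr) measurable
  interpret Y: prob_space Y unfolding Y_def by (rule prob_space_distr) measurable
  interpret XY: pair_sigma_finite X Y ..
  let ?f = "\<lambda>(\<theta>', z). gradQ \<theta>' z \<bullet> (\<theta>' - \<theta>)"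
  have "fst \<in> measurable (B\<Theta> \<Otimes>\<^sub>M S) B\<Theta>" by simp
  then have [measurable]: "fst \<in> borel_measurable (B\<Theta> \<Otimes>\<^sub>M S)" by (rule borel_measurable_B\<Theta>)
  have [measurable]: "(\<lambda>x. gradQ (fst x) (snd x)) \<in> borel_measurable (B\<Theta> \<Otimes>\<^sub>M S)"
    using gradQ_measurable by (simp add: case_prod_beta')
  have f [measurable]: "?f \<in> borel_measurable (B\<Theta> \<Otimes>\<^sub>M S)"
    unfolding case_prod_beta' by measurable
  have J: "distr P (B\<Theta> \<Otimes>\<^sub>M S) (\<lambda>\<omega>. (iterate i \<omega>, Zs (Suc i) \<omega>)) = X \<Otimes>\<^sub>M Y"
    unfolding X_def Y_def by (rule distr_iterate_Zs)
  \<comment> \<open>Fubini for this signed integrand needs joint integrability, which is transported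
    from \<open>P\<close>, where both factors are square integrable.\<close>
  have int: "integrable (X \<Otimes>\<^sub>M Y) ?f"
    unfolding J[symmetric] using subgradient_inner_integrable[of i \<theta>]
    by (subst integrable_distr_eq) (simp_all add: subgradient_def)
  have A_meas: "A \<in> borel_measurable B\<Theta>"
    using risk_lipschitz lipschitz_on_continuous_on borel_measurable_continuous_on_restrict by metis
  have A_int: "integrable P (\<lambda>\<omega>. A (iterate i \<omega>))"
    by (intro integrable_risk_compose iterate_mem iterate_integrable) measurable
  have "(\<integral>\<omega>. A (iterate i \<omega>) \<partial>P) - A \<theta> = (\<integral>\<omega>. A (iterate i \<omega>) - A \<theta> \<partial>P)"
    using A_int by (simp add: prob_space)
  also have "\<dots> = (\<integral>\<theta>'. A \<theta>' - A \<theta> \<partial>X)"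
    unfolding X_def using A_meas by (subst integral_distr) simp_all
  also have "\<dots> \<le> (\<integral>\<theta>'. \<integral>z. ?f (\<theta>', z) \<partial>Y \<partial>X)"
  proof (rule integral_mono)
    show "integrable X (\<lambda>\<theta>'. A \<theta>' - A \<theta>)"
      unfolding X_def using A_meas A_int by (subst integrable_distr_eq) simp_all
    show "integrable X (\<lambda>\<theta>'. \<integral>z. ?f (\<theta>', z) \<partial>Y)"
      by (rule XY.integrable_fst'[OF int])
    fix \<theta>' assume "\<theta>' \<in> space X"
    then have \<theta>': "\<theta>' \<in> \<Theta>" by (simp add: X_def)
    have meas: "gradQ \<theta>' \<in> borel_measurable S"
      using measurable_compose[OF measurable_Pair1' gradQ_measurable] \<theta>' by simp
    have "(\<integral>z. ?f (\<theta>', z) \<partial>Y) = (\<integral>\<omega>. gradQ \<theta>' (Zs (Suc i) \<omega>) \<bullet> (\<theta>' - \<theta>) \<partial>P)"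
      unfolding Y_def using meas by (subst integral_distr) simp_all
    \<comment> \<open>With the point \<open>\<theta>'\<close> frozen, the mean moves inside the
      inner product and becomes a sub-gradient of the risk; its inequality is then read towards the
      comparator \<open>\<theta>\<close>.\<close>
    also have "\<dots> = (\<integral>\<omega>. gradQ \<theta>' (Zs (Suc i) \<omega>) \<partial>P) \<bullet> (\<theta>' - \<theta>)"
      using gradQ_integrable[OF \<theta>', of "Suc i"] by (intro integral_inner_left) simp
    also have "\<dots> \<ge> A \<theta>' - A \<theta>"
      using gradQ_unbiased[OF \<theta>', of "Suc i"] assms
      by (auto simp: subdifferential_def inner_diff_right algebra_simps)
    finally show "A \<theta>' - A \<theta> \<le> (\<integral>z. ?f (\<theta>', z) \<partial>Y)" .
  qed
  also have "\<dots> = (\<integral>x. ?f x \<partial>(X \<Otimes>\<^sub>M Y))"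
    by (rule XY.integral_fst'[OF int])
  also have "\<dots> = (\<integral>\<omega>. subgradient i \<omega> \<bullet> (iterate i \<omega> - \<theta>) \<partial>P)"
    unfolding J[symmetric] by (subst integral_distr) (simp_all add: subgradient_def)
  finally show ?thesis .
qed

section \<open>The averaged estimate\<close>

definition estimate :: "nat \<Rightarrow> 'w \<Rightarrow> real ^ 'm" where
  "estimate t \<omega> = md_estimate \<Theta> V (\<lambda>_. 1) \<beta> \<theta>0 (\<lambda>i \<theta>. gradQ \<theta> (Zs i \<omega>)) t"

lemma estimate_eq: "estimate t \<omega> = (\<Sum>i<t. iterate i \<omega>) /\<^sub>R real t"
  unfolding estimate_def md_estimate_def iterate_def One_nat_def sum.atLeast1_atMost_eq by simp

lemma estimate_mem:
  assumes "1 \<le> t"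
  shows "estimate t \<omega> \<in> \<Theta>"
  unfolding estimate_eq scaleR_sum_right
  using assms by (intro convex_sum convex_\<Theta> iterate_mem) auto

text \<open>Jensen's inequality, obtained from one sub-gradient at the average: the deviations of
  the iterates from their mean sum to zero, so the linear terms cancel.\<close>

lemma risk_estimate_le:
  assumes "1 \<le> t"
  shows "A (estimate t \<omega>) \<le> (\<Sum>i<t. A (iterate i \<omega>)) / t"
proof -
  let ?e = "estimate t \<omega>"
  obtain g where "g \<in> subdifferential \<Theta> A ?e"
    using gradQ_unbiased[OF estimate_mem[OF assms], of 1] by auto
  then have "(\<Sum>i<t. A ?e + g \<bullet> (iterate i \<omega> - ?e)) \<le> (\<Sum>i<t. A (iterate i \<omega>))"
    using iterate_mem by (intro sum_mono) (auto simp: subdifferential_def)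
  moreover have "(\<Sum>i<t. g \<bullet> (iterate i \<omega> - ?e)) = 0"
    using assms by (simp add: inner_diff_right inner_sum_right[symmetric] sum_subtractf estimate_eq)
  ultimately show ?thesis using assms by (simp add: sum.distrib field_simps)
qed

lemma integrable_risk_estimate:
  assumes "1 \<le> t"
  shows "integrable P (\<lambda>\<omega>. A (estimate t \<omega>))"
proof (rule integrable_risk_compose)
  show int: "integrable P (estimate t)"
    unfolding estimate_eq[abs_def] using iterate_integrable by auto
  then show "estimate t \<in> borel_measurable P" by auto
qed (rule estimate_mem[OF assms])

text \<open>The comparator and the schedule are left general: Jensen reduces the estimate to the
  iterates, the pathwise regret is integrated, and each squared sub-gradient is replaced by its
  moment bound.\<close>

theorem expected_risk_estimate_le:
  assumes "1 \<le> t" "\<theta> \<in> \<Theta>"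
  shows "(\<integral>\<omega>. A (estimate t \<omega>) \<partial>P) - A \<theta> \<le> (\<beta> t * V \<theta> + (\<Sum>i<t. L\<^sup>2 / (2 * \<alpha> * \<beta> i))) / t"
proof -
  have A_int: "integrable P (\<lambda>\<omega>. A (iterate i \<omega>))" for i
    by (intro integrable_risk_compose iterate_mem iterate_integrable) measurable
  note moment = integrable_of_moment[OF subgradient_measurable subgradient_moment]
  have "(\<integral>\<omega>. A (estimate t \<omega>) \<partial>P) \<le> (\<integral>\<omega>. (\<Sum>i<t. A (iterate i \<omega>)) / t \<partial>P)"
    using integrable_risk_estimate[OF assms(1)] risk_estimate_le[OF assms(1)] A_int
    by (intro integral_mono) auto
  also have "\<dots> = (\<Sum>i<t. (\<integral>\<omega>. A (iterate i \<omega>) \<partial>P)) / t"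
    using A_int by simp
  finally have "(\<integral>\<omega>. A (estimate t \<omega>) \<partial>P) - A \<theta> \<le> (\<Sum>i<t. (\<integral>\<omega>. A (iterate i \<omega>) \<partial>P) - A \<theta>) / t"
    using assms(1) by (simp add: sum_subtractf diff_divide_distrib)
  also have "(\<Sum>i<t. (\<integral>\<omega>. A (iterate i \<omega>) \<partial>P) - A \<theta>)
      \<le> (\<Sum>i<t. \<integral>\<omega>. subgradient i \<omega> \<bullet> (iterate i \<omega> - \<theta>) \<partial>P)"
    using assms(2) by (intro sum_mono expected_risk_iterate_le)
  also have "\<dots> = (\<integral>\<omega>. (\<Sum>i<t. subgradient i \<omega> \<bullet> (iterate i \<omega> - \<theta>)) \<partial>P)"
    using subgradient_inner_integrable by simp
  also have "\<dots> \<le> (\<integral>\<omega>. \<beta> t * V \<theta> + (\<Sum>i<t. (infnorm (subgradient i \<omega>))\<^sup>2 / (2 * \<alpha> * \<beta> i)) \<partial>P)"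
  proof (rule integral_mono)
    fix \<omega>
    show "(\<Sum>i<t. subgradient i \<omega> \<bullet> (iterate i \<omega> - \<theta>))
      \<le> \<beta> t * V \<theta> + (\<Sum>i<t. (infnorm (subgradient i \<omega>))\<^sup>2 / (2 * \<alpha> * \<beta> i))"
      unfolding subgradient_def iterate_def
      by (rule md_regret[OF proxy \<theta>0 \<beta>_pos \<beta>_mono assms(2)])
  qed (use subgradient_inner_integrable moment in auto)
  also have "\<dots> = \<beta> t * V \<theta> + (\<Sum>i<t. (\<integral>\<omega>. (infnorm (subgradient i \<omega>))\<^sup>2 \<partial>P) / (2 * \<alpha> * \<beta> i))"
    using moment by (simp add: prob_space)
  also have "\<dots> \<le> \<beta> t * V \<theta> + (\<Sum>i<t. L\<^sup>2 / (2 * \<alpha> * \<beta> i))"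
    using moment \<alpha>_pos \<beta>_pos
    by (intro add_left_mono sum_mono divide_right_mono) (auto simp: less_imp_le)
  finally show ?thesis
    using assms(1) by (simp add: divide_right_mono)
qed

end

section \<open>The step-size schedule and its scale\<close>

text \<open>Each term is at most twice the increment of the square root: \<open>2 * ?a * ?b\<close>
  is at most \<open>?a\<^sup>2 + ?b\<^sup>2\<close>, which equals \<open>2 * ?b\<^sup>2 - 1\<close>,
  and dividing by \<open>?b\<close> gives the increment.\<close>

lemma sum_inverse_sqrt_le: "(\<Sum>i<t. 1 / sqrt (real i + 1)) \<le> 2 * sqrt t"
proof (induction t)
  case (Suc t)
  let ?a = "sqrt (real t)" and ?b = "sqrt (real t + 1)"
  have "2 * ?a * ?b \<le> ?a\<^sup>2 + ?b\<^sup>2"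
    using zero_le_power2[of "?a - ?b"] by (simp only: power2_diff)
  then have "1 / ?b \<le> 2 * ?b - 2 * ?a"
    by (simp add: field_simps)
  then show ?case using Suc by (simp add: add.commute)
qed simp

text \<open>After \<open>v\<close> is enlarged to \<open>V\<close>, this \<open>\<beta>0\<close>
  balances the two summands: each equals \<open>L\<close> times the square root of
  \<open>V / \<alpha>\<close>.\<close>

lemma mirror_descent_optimal_scale:
  fixes L \<alpha> \<beta>0 v V :: real
  assumes "\<alpha> > 0" "\<beta>0 > 0" "0 \<le> v" "v \<le> V" and \<beta>0: "\<beta>0 = L * (\<alpha> * V) powr (- 1 / 2)"
  shows "\<beta>0 * v + L\<^sup>2 / (\<alpha> * \<beta>0) \<le> 2 * L * (V / \<alpha>) powr (1 / 2)"
proof -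
  \<comment> \<open>As \<open>0 powr x\<close> is 0, a vanishing \<open>V\<close> would force
    \<open>\<beta>0 = 0\<close>.\<close>
  have "V \<noteq> 0" using \<beta>0 \<open>\<beta>0 > 0\<close> by auto
  then have V: "V > 0" using assms by simp
  define s r where "s = sqrt \<alpha>" and "r = sqrt V"
  have sr: "s > 0" "r > 0" "\<alpha> = s\<^sup>2" "V = r\<^sup>2"
    using V \<open>\<alpha> > 0\<close> by (simp_all add: s_def r_def)
  have "(\<alpha> * V) powr (- 1 / 2) = 1 / sqrt (\<alpha> * V)"
    using V \<open>\<alpha> > 0\<close> by (simp add: powr_minus powr_half_sqrt field_simps)
  then have b: "\<beta>0 = L / (s * r)"
    using \<beta>0 by (simp add: real_sqrt_mult s_def r_def)
  then have "L \<noteq> 0" using \<open>\<beta>0 > 0\<close> by auto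
  have "(V / \<alpha>) powr (1 / 2) = r / s"
    using V \<open>\<alpha> > 0\<close> by (simp add: powr_half_sqrt real_sqrt_divide s_def r_def)
  moreover have "\<beta>0 * v \<le> \<beta>0 * V"
    using assms(2,4) by (intro mult_left_mono) auto
  moreover have "\<beta>0 * V + L\<^sup>2 / (\<alpha> * \<beta>0) = 2 * L * (r / s)"
    unfolding b sr(3,4) using sr(1,2) \<open>L \<noteq> 0\<close> by (simp add: field_simps power2_eq_square)
  ultimately show ?thesis by simp
qed

section \<open>The risk bounds for the square-root schedule\<close>

theorem theorem2:
  fixes \<Theta> :: "(real ^ 'm) set"
    and P :: "'w measure" and S :: "'z measure"
    and Z :: "'w \<Rightarrow> 'z" and Zs :: "nat \<Rightarrow> 'w \<Rightarrow> 'z"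
    and Q :: "real ^ 'm \<Rightarrow> 'z \<Rightarrow> real"
    and gradQ :: "real ^ 'm \<Rightarrow> 'z \<Rightarrow> real ^ 'm"
    and V :: "real ^ 'm \<Rightarrow> real"
    and L \<alpha> \<beta>0 :: real
    and \<theta>0 \<theta>A :: "real ^ 'm"
    and t :: nat
  assumes "convex \<Theta>" and "closed \<Theta>"
    and "prob_space P"
    and "Z \<in> measurable P S"
    and "\<forall>\<theta>\<in>\<Theta>. \<forall>z\<in>space S. 0 \<le> Q \<theta> z"
    and "AE \<omega> in P. convex_on \<Theta> (\<lambda>\<theta>. Q \<theta> (Z \<omega>))"
    and "\<forall>\<theta>\<in>\<Theta>. integrable P (\<lambda>\<omega>. Q \<theta> (Z \<omega>))"
    and "prob_space.indep_vars P (\<lambda>_. S) Zs {1..}"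
    and "\<forall>i\<ge>1. distr P S (Zs i) = distr P S Z"
    and "(\<lambda>(\<theta>, z). gradQ \<theta> z) \<in> borel_measurable (restrict_space borel \<Theta> \<Otimes>\<^sub>M S)"
    and "\<forall>\<theta>\<in>\<Theta>. \<forall>i\<ge>1.
           integrable P (\<lambda>\<omega>. gradQ \<theta> (Zs i \<omega>)) \<and>
           (\<integral>\<omega>. gradQ \<theta> (Zs i \<omega>) \<partial>P) \<in> subdifferential \<Theta> (risk P Z Q) \<theta>"
    and "(SUP \<theta>\<in>\<Theta>. \<integral>\<^sup>+\<omega>. ennreal ((infnorm (gradQ \<theta> (Z \<omega>)))\<^sup>2) \<partial>P) \<le> ennreal (L\<^sup>2)"
    and "\<alpha> > 0" and "proxy_function \<Theta> V \<alpha>"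
    and "is_arg_min V (\<lambda>\<theta>. \<theta> \<in> \<Theta>) \<theta>0"
    and "is_arg_min (risk P Z Q) (\<lambda>\<theta>. \<theta> \<in> \<Theta>) \<theta>A"
    and "\<beta>0 > 0" and "t \<ge> 1"
  shows
    "let A = risk P Z Q;
         est = (\<lambda>\<omega>. md_estimate \<Theta> V (\<lambda>_. 1) (\<lambda>i. \<beta>0 * sqrt (real i + 1)) \<theta>0
                      (\<lambda>i \<theta>. gradQ \<theta> (Zs i \<omega>)) t);
         excess = (\<integral>\<omega>. A (est \<omega>) \<partial>P) - (INF \<theta>\<in>\<Theta>. A \<theta>)
     in integrable P (\<lambda>\<omega>. A (est \<omega>)) \<and>
        excess \<le> (\<beta>0 * V \<theta>A + L\<^sup>2 / (\<alpha> * \<beta>0)) * (sqrt (real t + 1) / real t) \<and>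
        (\<forall>Vbar. V \<theta>A \<le> Vbar \<and> \<beta>0 = L * (\<alpha> * Vbar) powr (- 1 / 2) \<longrightarrow>
           excess \<le> 2 * L * (Vbar / \<alpha>) powr (1 / 2) * (sqrt (real t + 1) / real t)) \<and>
        (compact \<Theta> \<longrightarrow>
           (\<forall>\<theta>max. is_arg_max V (\<lambda>\<theta>. \<theta> \<in> \<Theta>) \<theta>max \<longrightarrow>
              V \<theta>A \<le> V \<theta>max \<and>
              (\<beta>0 = L * (\<alpha> * V \<theta>max) powr (- 1 / 2) \<longrightarrow>
                 excess \<le> 2 * L * (V \<theta>max / \<alpha>) powr (1 / 2) * (sqrt (real t + 1) / real t))))"
proof -
  \<comment> \<open>The schedule is extended to index 0 by \<open>\<beta> 0 = \<beta>0\<close>, the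
    parameter of the initial potential; at \<open>t\<close> it supplies the factor
    \<open>sqrt (real t + 1)\<close>.\<close>
  define \<beta> where "\<beta> i = \<beta>0 * sqrt (real i + 1)" for i
  interpret prob_space P by fact
  have \<theta>A: "\<theta>A \<in> \<Theta>" "\<And>\<theta>. \<theta> \<in> \<Theta> \<Longrightarrow> risk P Z Q \<theta>A \<le> risk P Z Q \<theta>"
    using assms(16) by (auto simp: is_arg_min_linorder)
  interpret stochastic_mirror_descent P \<Theta> S Zs gradQ V "risk P Z Q" L \<alpha> \<theta>0 \<beta>
  proof unfold_locales
    fix \<theta> and i :: nat
    assume \<theta>: "\<theta> \<in> \<Theta>" and i: "1 \<le> i"
    show "integrable P (\<lambda>\<omega>. gradQ \<theta> (Zs i \<omega>))"
      "(\<integral>\<omega>. gradQ \<theta> (Zs i \<omega>) \<partial>P) \<in> subdifferential \<Theta> (risk P Z Q) \<theta>"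
      using assms(11) \<theta> i by auto
    have [measurable]: "gradQ \<theta> \<in> borel_measurable S"
      using measurable_compose[OF measurable_Pair1' assms(10)] \<theta> by (simp add: space_restrict_space)
    have [measurable]: "Zs i \<in> measurable P S" "Z \<in> measurable P S"
      using assms(4,8) i by (auto simp: indep_vars_def)
    let ?m = "\<lambda>z. ennreal ((infnorm (gradQ \<theta> z))\<^sup>2)"
    \<comment> \<open>The moment bound is given for \<open>Z\<close> and passes to each observation
      through the common law.\<close>
    have "(\<integral>\<^sup>+\<omega>. ?m (Zs i \<omega>) \<partial>P) = (\<integral>\<^sup>+z. ?m z \<partial>distr P S (Zs i))"
      by (subst nn_integral_distr) simp_all
    also have "\<dots> = (\<integral>\<^sup>+\<omega>. ?m (Z \<omega>) \<partial>P)"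
      using assms(9) i by (simp add: nn_integral_distr)
    also have "\<dots> \<le> (SUP \<theta>\<in>\<Theta>. \<integral>\<^sup>+\<omega>. ennreal ((infnorm (gradQ \<theta> (Z \<omega>)))\<^sup>2) \<partial>P)"
      using \<theta> by (rule SUP_upper)
    finally show "(\<integral>\<^sup>+\<omega>. ?m (Zs i \<omega>) \<partial>P) \<le> ennreal (L\<^sup>2)"
      using assms(12) by (rule order_trans)
  next
    show "incseq \<beta>"
      using \<open>\<beta>0 > 0\<close> by (auto simp: incseq_def \<beta>_def intro!: mult_left_mono)
  qed (use assms in \<open>auto simp: \<beta>_def\<close>)
  define excess where "excess = (\<integral>\<omega>. risk P Z Q (estimate t \<omega>) \<partial>P) - (INF \<theta>\<in>\<Theta>. risk P Z Q \<theta>)"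
  define rate where "rate = sqrt (real t + 1) / real t"
  have V_nonneg: "0 \<le> V \<theta>A" using assms(14) \<theta>A by (simp add: proxy_function_def)
  have "(INF \<theta>\<in>\<Theta>. risk P Z Q \<theta>) = risk P Z Q \<theta>A"
    using \<theta>A by (intro cInf_eq_minimum) auto
  then have "excess \<le> (\<beta> t * V \<theta>A + (\<Sum>i<t. L\<^sup>2 / (2 * \<alpha> * \<beta> i))) / t"
    using expected_risk_estimate_le[OF \<open>t \<ge> 1\<close> \<theta>A(1)] by (simp add: excess_def)
  also have "(\<Sum>i<t. L\<^sup>2 / (2 * \<alpha> * \<beta> i)) = L\<^sup>2 / (2 * \<alpha> * \<beta>0) * (\<Sum>i<t. 1 / sqrt (real i + 1))"
    by (simp add: \<beta>_def sum_distrib_left mult.assoc)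
  \<comment> \<open>The factor 2 cancels the one in the regret bound, and enlarging
    \<open>sqrt t\<close> to \<open>sqrt (real t + 1)\<close> gives both summands the same
    rate.\<close>
  also have "\<dots> \<le> L\<^sup>2 / (2 * \<alpha> * \<beta>0) * (2 * sqrt (real t + 1))"
    using assms(13,17) by (intro mult_left_mono order_trans[OF sum_inverse_sqrt_le]) auto
  finally have main: "excess \<le> (\<beta>0 * V \<theta>A + L\<^sup>2 / (\<alpha> * \<beta>0)) * rate"
    by (simp add: \<beta>_def rate_def divide_right_mono algebra_simps add_divide_distrib)
  have tuned: "excess \<le> 2 * L * (Vbar / \<alpha>) powr (1 / 2) * rate"
    if "V \<theta>A \<le> Vbar" "\<beta>0 = L * (\<alpha> * Vbar) powr (- 1 / 2)" for Vbar
    using main mirror_descent_optimal_scale[OF assms(13,17) V_nonneg that]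
    by (rule order_trans[OF _ mult_right_mono]) (simp add: rate_def)
  have est: "md_estimate \<Theta> V (\<lambda>_. 1) (\<lambda>i. \<beta>0 * sqrt (real i + 1)) \<theta>0 (\<lambda>i \<theta>. gradQ \<theta> (Zs i \<omega>)) t
      = estimate t \<omega>" for \<omega>
    unfolding estimate_def by (simp add: \<beta>_def[abs_def])
  \<comment> \<open>So the compact case is the tuned bound at
    \<open>Vbar = V \<theta>max\<close>.\<close>
  have "V \<theta>A \<le> V \<theta>max" if "is_arg_max V (\<lambda>\<theta>. \<theta> \<in> \<Theta>) \<theta>max" for \<theta>max
    using that \<theta>A(1) by (simp add: is_arg_max_linorder)
  then show ?thesis
    unfolding Let_def est excess_def[symmetric] rate_def[symmetric]
    using integrable_risk_estimate[OF \<open>t \<ge> 1\<close>] main tuned by blast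
qed

end
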